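(* Let $p\in[1,\infty)$, and work on the real line ($n=1$). (i) If there exist $\beta,\gamma\in\mathbb{R}$ and $C\in(0,\infty)$ such that, for any $\upsilon\in A_1(\mathbb{R})$ and $f\in\dot W^{1,p}_\upsilon(\mathbb{R})$, $$\sup_{\lambda\in(0,\infty)}\lambda^p\sum_{I\in\mathcal{D}^{0}_{\lambda,\beta+1-\frac1p}[f]}|I|^{\beta p-1}\upsilon(I)\le C[\upsilon]_{A_1(\mathbb{R})}^\gamma\|f'\|^p_{L^p_\upsilon(\mathbb{R})},$$ then $\gamma\ge1$. (ii) If $p\in(1,\infty)$ and there exist $\gamma\in\mathbb{R}$ and $C\in(0,\infty)$ such that, for any $\upsilon\in A_p(\mathbb{R})$ and $f\in\dot W^{1,p}_\upsilon(\mathbb{R})$, $$\sup_{\lambda\in(0,\infty)}\lambda^p\sum_{I\in\mathcal{D}^{\frac13}_{\lambda,0}[f]}|I|^{-p}\upsilon(I)\le C[\upsilon]_{A_p(\mathbb{R})}^\gamma\|f'\|^p_{L^p_\upsilon(\mathbb{R})},$$ then $\gamma\ge\frac p{p-1}$. (iii) If $p\in(1,\infty)$, $\beta_0\in(\frac1p-1,\frac1p)$, and there exist $\gamma\in\mathbb{R}$ and $C\in(0,\infty)$ such that, for any $\beta\in(\frac1p-1,\beta_0)$, $\upsilon\in A_p(\mathbb{R})$, and $f\in\dot W^{1,p}_\upsilon(\mathbb{R})$, $$\sup_{\lambda\in(0,\infty)}\lambda^p\sum_{I\in\mathcal{D}^{\frac13}_{\lambda,\beta+1-\frac1p}[f]}|I|^{\beta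 p-1}\upsilon(I)\le C[\upsilon]_{A_p(\mathbb{R})}^\gamma\|f'\|^p_{L^p_\upsilon(\mathbb{R})},$$ then $\gamma\ge\frac p{p-1}$.
   Context: For $\alpha\in\{0,\frac13\}$, $\mathcal{D}^\alpha:=\{2^j[m+[0,1)+(-1)^j\alpha]:j,m\in\mathbb{Z}\}$ (a family of intervals in $\mathbb{R}$). For a bounded interval $I$ and $f\in L^1_{\rm loc}(\mathbb{R})$, $\omega_I(f):=|I|^{-2}\int_I\int_I|f(x)-f(y)|\,dx\,dy$; for $\lambda\in(0,\infty)$ and $b\in\mathbb{R}$, $\mathcal{D}^\alpha_{\lambda,b}[f]:=\{I\in\mathcal{D}^\alpha:\omega_I(f)>\lambda|I|^b\}$. For a nonnegative locally integrable $\upsilon$ on $\mathbb{R}$, $\upsilon(I):=\int_I\upsilon$, and $\upsilon\in A_p(\mathbb{R})$ means $[\upsilon]_{A_p(\mathbb{R})}<\infty$, where, with suprema over all bounded intervals $I$, $[\upsilon]_{A_p(\mathbb{R})}:=\sup_I\big[\frac1{|I|}\int_I\upsilon\big]\big[\frac1{|I|}\int_I\upsilon^{-\frac1{p-1}}\big]^{p-1}$ for $p\in(1,\infty)$ and $[\upsilon]_{A_1(\mathbb{R})}:=\sup_I\big[\frac1{|I|}\int_I\upsilon\big]\|\upsilon^{-1}\|_{L^\infty(I)}$. $\|g\|_{L^p_\upsilon(\mathbb{R})}:=(\int_{\mathbb{R}}|g|^p\upsilon\,dx)^{1/p}$, and $\dot W^{1,p}_\upsilon(\mathbb{R})$ is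 the set of all $f\in L^1_{\rm loc}(\mathbb{R})$ whose weak derivative $f'$ exists and lies in $L^p_\upsilon(\mathbb{R})$. *)

theory Defs
  imports "HOL-Analysis.Analysis" "HOL-Probability.Essential_Supremum"
begin

(* Only meant for exponents a > 0, where the value at infinity is infinity. *)
definition ennreal_powr :: "ennreal \<Rightarrow> real \<Rightarrow> ennreal" where
  "ennreal_powr x a = (if x = \<infinity> then \<infinity> else ennreal (enn2real x powr a))"

definition locally_integrable :: "(real \<Rightarrow> real) \<Rightarrow> bool" where
  "locally_integrable f \<longleftrightarrow> (\<forall>K. compact K \<longrightarrow> f absolutely_integrable_on K)"

definition bounded_intervals :: "real set set" where
  "bounded_intervals = {I. is_interval I \<and> bounded I \<and> 0 < measure lebesgue I}"

definition shifted_dyadic :: "real \<Rightarrow> real set set" where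
  "shifted_dyadic \<alpha> =
     {(\<lambda>t. 2 powi j * (of_int m + t + (- 1) powi j * \<alpha>)) ` {0..<1} | j m :: int. True}"

definition oscillation :: "real set \<Rightarrow> (real \<Rightarrow> real) \<Rightarrow> real" where
  "oscillation I f =
     (LINT x:I|lebesgue. (LINT y:I|lebesgue. \<bar>f x - f y\<bar>)) / (measure lebesgue I)\<^sup>2"

definition dyadic_level :: "real \<Rightarrow> real \<Rightarrow> real \<Rightarrow> (real \<Rightarrow> real) \<Rightarrow> real set set" where
  "dyadic_level \<alpha> l b f =
     {I \<in> shifted_dyadic \<alpha>. oscillation I f > l * measure lebesgue I powr b}"

definition weight_of :: "(real \<Rightarrow> real) \<Rightarrow> real set \<Rightarrow> ennreal" where
  "weight_of v I = (\<integral>\<^sup>+x\<in>I. ennreal (v x) \<partial>lebesgue)"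

(* Negative powers of v are reciprocals in ennreal, so they are infinite where v vanishes.
   Since 0 * \<infinity> = 0 in ennreal, a weight vanishing almost everywhere gets constant 0; a
   weight that vanishes on a set of positive measure, but not almost everywhere, gets \<infinity>. *)
definition A_const :: "real \<Rightarrow> (real \<Rightarrow> real) \<Rightarrow> ennreal" where
  "A_const p v =
     (if p = 1 then
        (SUP I\<in>bounded_intervals.
           weight_of v I / emeasure lebesgue I
           * esssup (restrict_space lebesgue I) (\<lambda>x. inverse (ennreal (v x))))
      else
        (SUP I\<in>bounded_intervals.
           weight_of v I / emeasure lebesgue I
           * ennreal_powr
               ((\<integral>\<^sup>+x\<in>I. inverse (ennreal (v x powr (1 / (p - 1)))) \<partial>lebesgue)
                / emeasure lebesgue I) (p - 1)))"

definition A_class :: "real \<Rightarrow> (real \<Rightarrow> real) set" where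
  "A_class p = {v. (\<forall>x. 0 \<le> v x) \<and> locally_integrable v \<and> A_const p v < \<infinity>}"

definition test_function :: "(real \<Rightarrow> real) \<Rightarrow> bool" where
  "test_function \<phi> \<longleftrightarrow>
     (\<forall>k x. (deriv ^^ k) \<phi> differentiable (at x)) \<and> compact (closure {x. \<phi> x \<noteq> 0})"

definition has_weak_derivative :: "(real \<Rightarrow> real) \<Rightarrow> (real \<Rightarrow> real) \<Rightarrow> bool" where
  "has_weak_derivative f g \<longleftrightarrow>
     locally_integrable f \<and> locally_integrable g \<and>
     (\<forall>\<phi>. test_function \<phi> \<longrightarrow>
        (LINT x|lebesgue. f x * deriv \<phi> x) = - (LINT x|lebesgue. g x * \<phi> x))"

definition weighted_norm :: "real \<Rightarrow> (real \<Rightarrow> real) \<Rightarrow> (real \<Rightarrow> real) \<Rightarrow> ennreal" where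
  "weighted_norm p v g =
     ennreal_powr (\<integral>\<^sup>+x. ennreal (\<bar>g x\<bar> powr p * v x) \<partial>lebesgue) (1 / p)"

definition sobolev :: "real \<Rightarrow> (real \<Rightarrow> real) \<Rightarrow> (real \<Rightarrow> real) set" where
  "sobolev p v =
     {f. locally_integrable f \<and> (\<exists>g. has_weak_derivative f g \<and> weighted_norm p v g < \<infinity>)}"

end

theory Submission
  imports Defs
begin

text \<open>All three lower bounds come from power weights close to the border of the Muckenhoupt class,
measured by a small parameter \<open>d > 0\<close>. Everything rests on one estimate (\<open>average_abs_powr_le\<close>): the
average of \<open>|x| powr (d - 1)\<close> over an interval \<open>I\<close> is at most \<open>4 / d\<close> times \<open>R powr (d - 1)\<close>, where
\<open>R\<close> is the largest modulus of a point of \<open>I\<close>.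

For the class of exponent 1 take \<open>v = |x| powr (d - 1)\<close>, whose constant is at most \<open>4 / d\<close>. A function
that rises linearly on \<open>[1/2, 1]\<close> and is constant elsewhere has a derivative of bounded weighted norm,
but the interval \<open>[0, 1)\<close>, on which it oscillates, has weight at least \<open>1 / (2 d)\<close> (\<open>ramp_test\<close>).
Hence \<open>1 / d\<close> is at most a constant times \<open>d powr (- \<gamma>)\<close>.

For \<open>p > 1\<close> take \<open>v = |x| powr ((p - 1) * (1 - d))\<close>, the weight dual to the previous one; its constant is
at most \<open>(4 / d) powr (p - 1)\<close>. Take \<open>f = x powr d\<close> on \<open>[0, 1]\<close>, continued by 0 and 1. The p-th power of
the norm of \<open>f'\<close> is \<open>d powr (p - 1)\<close>. At all scales between \<open>4 powr (- 1 / d)\<close> and 1, \<open>f\<close> is nearly a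
jump at 0, and the dyadic grid shifted by one third has intervals around 0 at these scales. There are
about \<open>1 / d\<close> of them and each contributes a fixed amount to the sum on the left
(\<open>truncated_power_test\<close>). Hence \<open>1 / d\<close> is at most a constant times
\<open>d powr (- (p - 1) * \<gamma>) * d powr (p - 1)\<close>, that is, \<open>p \<le> (p - 1) * \<gamma>\<close> (\<open>exponent_comparison\<close>).
These comparisons presuppose \<open>\<gamma> \<ge> 0\<close>; a negative \<open>\<gamma>\<close> is excluded since the constants of the weights
are bounded away from 0.
The contributions are fixed also when the level condition carries a factor \<open>|I| powr b\<close> with
\<open>0 \<le> b \<le> d\<close>, since \<open>|I| powr d\<close> is at least \<open>1 / 4\<close> on these scales. This covers at the same time the
endpoint inequality and the inequalities near it whose constant is uniform.\<close>

section \<open>Bounded intervals and local integrability\<close>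

lemma bounded_intervals_bounds:
  assumes "I \<in> bounded_intervals"
  obtains a b :: real where "a < b" "{a<..<b} \<subseteq> I" "I \<subseteq> {a..b}" "I \<in> sets lebesgue"
    "emeasure lebesgue I = ennreal (b - a)"
proof -
  from assms have I: "is_interval I" "bounded I" "0 < measure lebesgue I"
    by (auto simp: bounded_intervals_def)
  have ne: "I \<noteq> {}" using I(3) by auto
  define a b where "a = Inf I" and "b = Sup I"
  have bdd: "bdd_below I" "bdd_above I"
    using I(2) bounded_imp_bdd_below bounded_imp_bdd_above by auto
  have up: "I \<subseteq> {a..b}"
    using bdd by (auto simp: a_def b_def intro: cInf_lower cSup_upper)
  have lo: "{a<..<b} \<subseteq> I"
  proof
    fix x assume "x \<in> {a<..<b}"
    then obtain y z where "y \<in> I" "y < x" "z \<in> I" "x < z"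
      using cInf_lessD[OF ne] less_cSupD[OF ne] unfolding a_def b_def by force
    then show "x \<in> I" using I(1) unfolding is_interval_1 by (meson less_imp_le)
  qed
  have meas: "I \<in> sets lebesgue"
    using I(1,2) by (simp add: is_interval_convex_1 measurable_convex fmeasurableD)
  have ab: "a < b"
  proof (rule ccontr)
    assume "\<not> a < b"
    then have "I \<subseteq> {a}" using up by auto
    then have "negligible I" using negligible_subset negligible_sing by blast
    then show False using I(3) by (simp add: negligible_imp_measure0)
  qed
  have "emeasure lebesgue I \<le> emeasure lebesgue {a..b}"
    using up by (intro emeasure_mono) auto
  moreover have "emeasure lebesgue {a<..<b} \<le> emeasure lebesgue I"
    using lo meas by (intro emeasure_mono) auto
  ultimately have "emeasure lebesgue I = ennreal (b - a)" using ab by simp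
  with that ab lo up meas show ?thesis by blast
qed

lemma atLeastAtMost_in_bounded_intervals:
  assumes "a < (b::real)" shows "{a..b} \<in> bounded_intervals"
  using assms by (auto simp: bounded_intervals_def is_interval_cc)

lemma weight_of_mono:
  assumes "\<And>x. x \<in> I \<Longrightarrow> v x \<le> w x" "I \<subseteq> J"
  shows "weight_of v I \<le> weight_of w J"
  unfolding weight_of_def using assms
  by (intro nn_integral_mono) (auto simp: indicator_def intro: ennreal_leI)

lemma weight_of_const:
  assumes "I \<in> sets lebesgue"
  shows "weight_of (\<lambda>x. c) I = ennreal c * emeasure lebesgue I"
  unfolding weight_of_def using assms by (rule nn_integral_cmult_indicator)

lemma has_integral_abs_powr:
  assumes "0 < d" "0 \<le> (r::real)"
  shows "((\<lambda>x. \<bar>x\<bar> powr (d - 1)) has_integral (r powr d / d)) {0..r}"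
proof -
  have "((\<lambda>x. x powr (d - 1)) has_integral (r powr d / d)) {0..r}"
    using has_integral_powr_from_0[of "d - 1" r] assms by simp
  then show ?thesis by (rule has_integral_eq[rotated]) auto
qed

lemma weight_of_abs_powr_Icc:
  assumes "0 < d" "0 \<le> (r::real)"
  shows "weight_of (\<lambda>x. \<bar>x\<bar> powr (d - 1)) {0..r} = ennreal (r powr d / d)"
  unfolding weight_of_def nn_integral_completion
  by (rule nn_integral_has_integral_lebesgue'[OF _ has_integral_abs_powr[OF assms]]) auto

lemma weight_of_abs_powr_symmetric:
  assumes "0 < d" "0 \<le> (r::real)"
  shows "weight_of (\<lambda>x. \<bar>x\<bar> powr (d - 1)) {- r..r} = ennreal (2 * r powr d / d)"
proof -
  note pos = has_integral_abs_powr[OF assms]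
  have neg: "((\<lambda>x. \<bar>x\<bar> powr (d - 1)) has_integral (r powr d / d)) {- r..0}"
    using pos has_integral_reflect_real[of "\<lambda>x. \<bar>x\<bar> powr (d - 1)" "r powr d / d" r 0] by simp
  have "((\<lambda>x. \<bar>x\<bar> powr (d - 1)) has_integral (2 * r powr d / d)) {- r..r}"
    using has_integral_combine[OF _ _ neg pos] assms by simp
  then show ?thesis
    unfolding weight_of_def nn_integral_completion
    by (intro nn_integral_has_integral_lebesgue') auto
qed

lemma borel_measurable_lebesgueI: "f \<in> borel_measurable borel \<Longrightarrow> f \<in> borel_measurable lebesgue"
  for f :: "real \<Rightarrow> real"
  by (simp add: borel_measurable_if_D measurable_completion)

lemma bounded_subset_symmetric_Icc:
  assumes "bounded (K :: real set)"
  obtains r where "0 \<le> r" "K \<subseteq> {- r..r}"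
proof -
  obtain r where r: "\<And>x. x \<in> K \<Longrightarrow> \<bar>x\<bar> \<le> r" using assms unfolding bounded_iff by auto
  show ?thesis by (rule that[of "\<bar>r\<bar>"]) (use r in force)+
qed

lemma locally_integrable_if_weight_finite:
  assumes "f \<in> borel_measurable borel" "\<And>r. 0 \<le> r \<Longrightarrow> weight_of (\<lambda>x. \<bar>f x\<bar>) {- r..r} < \<infinity>"
  shows "locally_integrable f"
  unfolding locally_integrable_def
proof (intro allI impI)
  fix K :: "real set" assume K: "compact K"
  obtain r where r: "0 \<le> r" "K \<subseteq> {- r..r}"
    using bounded_subset_symmetric_Icc compact_imp_bounded[OF K] by metis
  have [measurable]: "f \<in> borel_measurable lebesgue"
    using assms(1) by (rule borel_measurable_lebesgueI)
  have "set_integrable lebesgue {- r..r} f"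
    unfolding set_integrable_def
  proof (rule integrableI_bounded)
    have "(\<integral>\<^sup>+x. ennreal (norm (indicat_real {- r..r} x *\<^sub>R f x)) \<partial>lebesgue)
        = weight_of (\<lambda>x. \<bar>f x\<bar>) {- r..r}"
      unfolding weight_of_def by (intro nn_integral_cong) (auto simp: indicator_def)
    then show "(\<integral>\<^sup>+x. ennreal (norm (indicat_real {- r..r} x *\<^sub>R f x)) \<partial>lebesgue) < \<infinity>"
      using assms(2)[OF r(1)] by simp
  qed (intro borel_measurable_scaleR borel_measurable_indicator, auto)
  then show "f absolutely_integrable_on K"
    by (rule set_integrable_subset) (use r K in \<open>auto simp: lmeasurable_compact fmeasurableD\<close>)
qed

lemma continuous_imp_locally_integrable:
  assumes "continuous_on UNIV f" shows "locally_integrable f"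
  unfolding locally_integrable_def
proof (intro allI impI)
  fix K :: "real set" assume K: "compact K"
  obtain r where r: "0 \<le> r" "K \<subseteq> {- r..r}"
    using bounded_subset_symmetric_Icc compact_imp_bounded[OF K] by metis
  have "f absolutely_integrable_on {- r..r}"
    using assms continuous_on_subset by (intro absolutely_integrable_continuous_real) blast
  then show "f absolutely_integrable_on K"
    by (rule set_integrable_subset) (use r K in \<open>auto simp: lmeasurable_compact fmeasurableD\<close>)
qed

lemma locally_integrable_abs_powr:
  assumes "-1 < s" shows "locally_integrable (\<lambda>x. \<bar>x\<bar> powr s)"
proof (rule locally_integrable_if_weight_finite)
  fix r :: real assume "0 \<le> r"
  then show "weight_of (\<lambda>x. \<bar>\<bar>x\<bar> powr s\<bar>) {- r..r} < \<infinity>"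
    using weight_of_abs_powr_symmetric[of "s + 1" r] assms by simp
qed measurable

section \<open>Weak derivatives and lower bounds for oscillations\<close>

text \<open>The product \<open>f \<phi>\<close> is a continuous antiderivative of \<open>f \<phi>' + g \<phi>\<close> off a finite set, so the
fundamental theorem of calculus on an interval containing the support of \<open>\<phi>\<close> in its interior
gives the integral zero. Each summand is absolutely integrable, so the integral may be split.
The derivative may be unbounded near the exceptional points, as \<open>x powr (d - 1)\<close> is at 0.\<close>

lemma has_weak_derivative_if_piecewise:
  assumes "finite S" "continuous_on UNIV f" and g: "locally_integrable g"
    and der: "\<And>x. x \<notin> S \<Longrightarrow> (f has_real_derivative g x) (at x)"
  shows "has_weak_derivative f g"
  unfolding has_weak_derivative_def
proof (intro conjI allI impI)
  show "locally_integrable f" by (rule continuous_imp_locally_integrable) fact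
  show "locally_integrable g" by fact
  fix \<phi> assume t: "test_function \<phi>"
  have dphi: "(\<phi> has_real_derivative deriv \<phi> x) (at x)" for x
  proof -
    have "\<phi> differentiable (at x)"
      using t unfolding test_function_def by (metis funpow_0)
    then show ?thesis by (simp add: DERIV_deriv_iff_real_differentiable)
  qed
  have cphi: "continuous_on A \<phi>" for A
    using dphi by (meson DERIV_isCont continuous_at_imp_continuous_on)
  have ddphi: "deriv \<phi> differentiable (at x)" for x
    using t unfolding test_function_def by (metis funpow_0 funpow_simps_right(2) o_apply funpow.simps(2))
  have cdphi: "continuous_on A (deriv \<phi>)" for A
    using ddphi by (meson differentiable_imp_continuous_within continuous_at_imp_continuous_on)
  have "bounded {x. \<phi> x \<noteq> 0}"
    using t compact_imp_bounded bounded_subset closure_subset unfolding test_function_def by metis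
  then obtain M0 where M0: "\<And>x. \<phi> x \<noteq> 0 \<Longrightarrow> \<bar>x\<bar> \<le> M0"
    unfolding bounded_iff by auto
  define M where "M = \<bar>M0\<bar> + 1"
  have M: "0 < M" and out: "\<And>x. M \<le> \<bar>x\<bar> \<Longrightarrow> \<phi> x = 0" 
    unfolding M_def using M0 by force+
  have dout: "deriv \<phi> x = 0" if "M < \<bar>x\<bar>" for x
  proof -
    have "((\<lambda>x. 0) has_real_derivative 0) (at x)" by simp
    moreover have "open {x. M < \<bar>x\<bar>}" by (intro open_Collect_less continuous_intros)
    ultimately have "(\<phi> has_real_derivative 0) (at x)"
      by (rule has_field_derivative_transform_within_open) (use that out in auto)
    then show ?thesis by (rule DERIV_imp_deriv)
  qed
  have int: "((\<lambda>x. f x * deriv \<phi> x + g x * \<phi> x) has_integral (f M * \<phi> M - f (- M) * \<phi> (- M))) {- M..M}"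
  proof (rule fundamental_theorem_of_calculus_interior_strong[OF assms(1)])
    fix x assume "x \<in> {- M<..<M} - S"
    then show "((\<lambda>x. f x * \<phi> x) has_vector_derivative f x * deriv \<phi> x + g x * \<phi> x) (at x)"
      using DERIV_mult[OF der dphi, of x] 
      by (simp add: has_real_derivative_iff_has_vector_derivative mult.commute add.commute)
  qed (use M cphi assms(2) in \<open>auto intro!: continuous_intros intro: continuous_on_subset\<close>)
  have fi: "(\<lambda>x. f x * deriv \<phi> x) absolutely_integrable_on {- M..M}"
    by (intro absolutely_integrable_continuous_real continuous_intros cdphi)
       (use assms(2) continuous_on_subset in blast)
  have gi: "(\<lambda>x. g x * \<phi> x) absolutely_integrable_on {- M..M}"
  proof -
    have "(\<lambda>x. \<phi> x * g x) absolutely_integrable_on {- M..M}"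
    proof (rule absolutely_integrable_bounded_measurable_product_real)
      show "\<phi> \<in> borel_measurable (lebesgue_on {- M..M})"
        by (intro continuous_imp_measurable_on_sets_lebesgue cphi) auto
      show "bounded (\<phi> ` {- M..M})"
        by (intro compact_imp_bounded compact_continuous_image cphi) auto
      show "g absolutely_integrable_on {- M..M}"
        using g unfolding locally_integrable_def by auto
    qed auto
    then show ?thesis by (simp add: mult.commute)
  qed
  have "(LINT x|lebesgue. f x * deriv \<phi> x) = (LINT x:{- M..M}|lebesgue. f x * deriv \<phi> x)"
    unfolding set_lebesgue_integral_def
    by (intro Bochner_Integration.integral_cong) (auto simp: indicator_def intro!: dout)
  also have "\<dots> = integral {- M..M} (\<lambda>x. f x * deriv \<phi> x)"
    using fi by (rule set_lebesgue_integral_eq_integral)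
  finally have 1: "(LINT x|lebesgue. f x * deriv \<phi> x) = integral {- M..M} (\<lambda>x. f x * deriv \<phi> x)" .
  have "(LINT x|lebesgue. g x * \<phi> x) = (LINT x:{- M..M}|lebesgue. g x * \<phi> x)"
    unfolding set_lebesgue_integral_def
    by (intro Bochner_Integration.integral_cong) (auto simp: indicator_def intro!: out)
  also have "\<dots> = integral {- M..M} (\<lambda>x. g x * \<phi> x)"
    using gi by (rule set_lebesgue_integral_eq_integral)
  finally have 2: "(LINT x|lebesgue. g x * \<phi> x) = integral {- M..M} (\<lambda>x. g x * \<phi> x)" .
  have "integral {- M..M} (\<lambda>x. f x * deriv \<phi> x) + integral {- M..M} (\<lambda>x. g x * \<phi> x) = 0"
    using int integral_add[OF set_lebesgue_integral_eq_integral(1)[OF fi] set_lebesgue_integral_eq_integral(1)[OF gi]]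
    using out[of M] out[of "- M"] M by (simp add: integral_unique)
  with 1 2 show "(LINT x|lebesgue. f x * deriv \<phi> x) = - (LINT x|lebesgue. g x * \<phi> x)" by simp
qed

text \<open>Only the rectangle \<open>A \<times> B\<close> of the double integral is kept. The iterated Bochner integral would be
zero if the inner integral failed to be integrable in the outer variable; continuity of \<open>f\<close>
excludes this, because the inner integral is then a Lipschitz function of \<open>f x\<close>.\<close>

lemma oscillation_ge:
  fixes f :: "real \<Rightarrow> real"
  assumes "continuous_on UNIV f" "I \<in> sets lebesgue" "bounded I"
    and AB: "A \<subseteq> I" "B \<subseteq> I" "A \<in> sets lebesgue" "B \<in> sets lebesgue"
    and t: "0 \<le> t" "\<And>x y. x \<in> A \<Longrightarrow> y \<in> B \<Longrightarrow> t \<le> \<bar>f x - f y\<bar>"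
  shows "t * measure lebesgue A * measure lebesgue B / (measure lebesgue I)\<^sup>2 \<le> oscillation I f"
proof -
  have I: "I \<in> lmeasurable" using assms(2,3) by (rule bounded_set_imp_lmeasurable[rotated])
  have A: "A \<in> lmeasurable" and B: "B \<in> lmeasurable" using I AB fmeasurableI2 by blast+
  obtain r where r: "I \<subseteq> {- r..r}"
    using bounded_subset_symmetric_Icc assms(3) by metis
  have cint: "set_integrable lebesgue I h" if "continuous_on UNIV h" for h :: "real \<Rightarrow> real"
  proof -
    have "h absolutely_integrable_on {- r..r}"
      using that continuous_on_subset by (intro absolutely_integrable_continuous_real) blast
    then show ?thesis by (rule set_integrable_subset) (use r assms(2) in auto)
  qed
  define G where "G x = (LINT y:I|lebesgue. \<bar>f x - f y\<bar>)" for x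
  have si: "set_integrable lebesgue I (\<lambda>y. \<bar>f x - f y\<bar>)" for x
    by (intro cint continuous_intros assms(1))
  have lip: "G x - G x' \<le> measure lebesgue I * \<bar>f x - f x'\<bar>" for x x'
  proof -
    have "G x \<le> (LINT y:I|lebesgue. \<bar>f x' - f y\<bar> + \<bar>f x - f x'\<bar>)"
      unfolding G_def by (intro set_integral_mono si cint continuous_intros assms(1)) auto
    also have "\<dots> = G x' + measure lebesgue I * \<bar>f x - f x'\<bar>"
      unfolding G_def using I assms(2)
      by (subst set_integral_add) (auto intro!: si cint simp: set_integral_const fmeasurable_def)
    finally show ?thesis by simp
  qed
  have lip': "\<bar>G x - G x'\<bar> \<le> measure lebesgue I * \<bar>f x - f x'\<bar>" for x x'
    using lip[of x x'] lip[of x' x] by (auto simp: abs_le_iff abs_minus_commute)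
  have cG: "continuous_on UNIV G"
    unfolding continuous_on_def
  proof (intro ballI)
    fix x :: real
    have "(f \<longlongrightarrow> f x) (at x)" using assms(1) by (simp add: continuous_on_def)
    then have "((\<lambda>y. measure lebesgue I * \<bar>f y - f x\<bar>) \<longlongrightarrow> measure lebesgue I * \<bar>f x - f x\<bar>) (at x)"
      by (intro tendsto_intros)
    then have "((\<lambda>y. measure lebesgue I * \<bar>f y - f x\<bar>) \<longlongrightarrow> 0) (at x)" by simp
    then have "((\<lambda>y. G y - G x) \<longlongrightarrow> 0) (at x)"
      by (rule Lim_null_comparison[rotated]) (auto intro!: always_eventually lip')
    then show "(G \<longlongrightarrow> G x) (at x)" by (simp add: LIM_zero_iff)
  qed
  have const: "set_integrable lebesgue I (\<lambda>x. indicator X x * c)" if "X \<in> lmeasurable" for X and c :: real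
  proof -
    have "integrable lebesgue (\<lambda>x. indicator (I \<inter> X) x * c)"
      using fmeasurable.Int[OF I that]
      by (intro integrable_mult_left integrable_real_indicator) (auto simp: fmeasurable_def simp del: emeasure_completion)
    then show ?thesis unfolding set_integrable_def by (simp add: indicator_inter_arith mult.assoc)
  qed
  have cval: "(LINT x:I|lebesgue. indicator X x * c) = measure lebesgue X * c"
    if "X \<in> lmeasurable" "X \<subseteq> I" for X and c :: real
  proof -
    have "(LINT x:I|lebesgue. indicator X x * c) = (LINT x|lebesgue. indicator X x * c)"
      unfolding set_lebesgue_integral_def using that(2)
      by (intro Bochner_Integration.integral_cong) (auto simp: indicator_def)
    then show ?thesis by simp
  qed
  have Gge: "indicator A x * (measure lebesgue B * t) \<le> G x" for x
  proof (cases "x \<in> A")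
    case True
    have "measure lebesgue B * t = (LINT y:I|lebesgue. indicator B y * t)"
      by (rule cval[OF B AB(2), symmetric])
    also have "\<dots> \<le> G x" unfolding G_def
      using True t by (intro set_integral_mono const B si) (auto simp: indicator_def)
    finally show ?thesis using True by simp
  next
    case False
    have "0 \<le> G x" unfolding G_def set_lebesgue_integral_def
      by (intro Bochner_Integration.integral_nonneg) auto
    then show ?thesis using False by simp
  qed
  have "measure lebesgue A * (measure lebesgue B * t)
      = (LINT x:I|lebesgue. indicator A x * (measure lebesgue B * t))"
    by (rule cval[OF A AB(1), symmetric])
  also have "\<dots> \<le> (LINT x:I|lebesgue. G x)"
    by (intro set_integral_mono const A cint cG Gge)
  finally show ?thesis
    unfolding oscillation_def G_def by (intro divide_right_mono) (auto simp: mult_ac)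
qed

section \<open>Muckenhoupt constants of power weights\<close>

text \<open>With \<open>R = sup {|x| : x \<in> I}\<close>, two cases suffice. If \<open>I\<close> is long (\<open>R \<le> 2 |I|\<close>), then the integral is at
most the one over \<open>[- R, R]\<close>, which is \<open>2 R powr d / d\<close>. If \<open>I\<close> is short, then \<open>|x| \<ge> R / 2\<close> on all
of \<open>I\<close>. The radius \<open>R\<close> is chosen before \<open>d\<close> and bounds \<open>|x|\<close> on \<open>I\<close>, so that the factor
\<open>R powr (d - 1)\<close> cancels in the products that define the Muckenhoupt constants.\<close>

lemma average_abs_powr_le:
  assumes "I \<in> bounded_intervals"
  obtains R where "0 < R" "\<And>x. x \<in> I \<Longrightarrow> \<bar>x\<bar> \<le> R"
    "\<And>d. 0 < d \<Longrightarrow> d \<le> 1 \<Longrightarrow>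
       weight_of (\<lambda>x. \<bar>x\<bar> powr (d - 1)) I / emeasure lebesgue I \<le> ennreal (4 / d * R powr (d - 1))"
proof -
  from assms obtain a b where ab: "a < b" "I \<subseteq> {a..b}" "I \<in> sets lebesgue"
    "emeasure lebesgue I = ennreal (b - a)"
    using bounded_intervals_bounds by metis
  define R where "R = max \<bar>a\<bar> \<bar>b\<bar>"
  have R: "0 < R" "\<And>x. x \<in> I \<Longrightarrow> \<bar>x\<bar> \<le> R" using ab(1,2) by (force simp: R_def)+
  have bound: "weight_of (\<lambda>x. \<bar>x\<bar> powr (d - 1)) I / emeasure lebesgue I \<le> ennreal (4 / d * R powr (d - 1))"
    if d: "0 < d" "d \<le> 1" for d
  proof -
    have "weight_of (\<lambda>x. \<bar>x\<bar> powr (d - 1)) I \<le> ennreal (4 / d * R powr (d - 1) * (b - a))"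
    proof (cases "R / 2 \<le> b - a")
      case True
      have "weight_of (\<lambda>x. \<bar>x\<bar> powr (d - 1)) I \<le> weight_of (\<lambda>x. \<bar>x\<bar> powr (d - 1)) {- R..R}"
        using R by (intro weight_of_mono) (auto simp: abs_le_iff minus_le_iff)
      also have "\<dots> = ennreal (2 * R powr d / d)"
        using R d by (simp add: weight_of_abs_powr_symmetric)
      also have "2 * R powr d / d = 4 / d * R powr (d - 1) * (R / 2)"
        using R by (simp add: powr_diff)
      also have "ennreal \<dots> \<le> ennreal (4 / d * R powr (d - 1) * (b - a))"
        using True d by (intro ennreal_leI mult_left_mono) auto
      finally show ?thesis .
    next
      case False
      have far: "R / 2 \<le> \<bar>x\<bar>" if "x \<in> I" for x
        using that ab(2) False ab(1) unfolding R_def by (fastforce simp: max_def abs_if split: if_splits)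
      have "weight_of (\<lambda>x. \<bar>x\<bar> powr (d - 1)) I \<le> weight_of (\<lambda>x. (R / 2) powr (d - 1)) I"
        using far R d by (intro weight_of_mono powr_mono2') auto
      also have "\<dots> = ennreal ((R / 2) powr (d - 1) * (b - a))"
        using ab by (simp add: weight_of_const ennreal_mult)
      also have "\<dots> \<le> ennreal (4 / d * R powr (d - 1) * (b - a))"
      proof (intro ennreal_leI mult_right_mono)
        have "(R / 2) powr (d - 1) = 2 powr (1 - d) * R powr (d - 1)"
          using R by (simp add: powr_divide powr_diff)
        also have "2 powr (1 - d) \<le> 2 powr (1::real)" using d by (intro powr_mono) auto
        also have "2 powr (1::real) \<le> 4 / d" using d by (simp add: field_simps)
        finally show "(R / 2) powr (d - 1) \<le> 4 / d * R powr (d - 1)"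
          by (simp add: mult_right_mono)
      qed (use ab in auto)
      finally show ?thesis .
    qed
    then have "weight_of (\<lambda>x. \<bar>x\<bar> powr (d - 1)) I / ennreal (b - a)
        \<le> ennreal (4 / d * R powr (d - 1) * (b - a)) / ennreal (b - a)"
      by (rule divide_right_mono_ennreal)
    also have "\<dots> = ennreal (4 / d * R powr (d - 1))"
      using ab(1) d by (subst divide_ennreal) auto
    finally show ?thesis using ab(4) by simp
  qed
  from that[OF R bound] show ?thesis .
qed

lemma AE_lebesgue_nonzero: "AE x in lebesgue. x \<noteq> (0::real)"
  by (intro AE_I'[of "{0}"]) auto

lemma average_ge:
  assumes "I \<in> bounded_intervals" "\<And>x. x \<in> I \<Longrightarrow> c \<le> v x"
  shows "ennreal c \<le> weight_of v I / emeasure lebesgue I"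
proof -
  from assms(1) obtain a b where ab: "a < b" "I \<in> sets lebesgue"
    "emeasure lebesgue I = ennreal (b - a)"
    using bounded_intervals_bounds by metis
  have "ennreal c * ennreal (b - a) \<le> weight_of v I"
    using weight_of_mono[of I "\<lambda>_. c" v I] weight_of_const[of I c] ab assms(2) by simp
  then have "ennreal c * ennreal (b - a) / ennreal (b - a) \<le> weight_of v I / ennreal (b - a)"
    by (rule divide_right_mono_ennreal)
  then show ?thesis using ab by (simp add: ennreal_mult_divide_eq)
qed

lemma average_le:
  assumes "I \<in> bounded_intervals" "\<And>x. x \<in> I \<Longrightarrow> v x \<le> c" 
  shows "weight_of v I / emeasure lebesgue I \<le> ennreal c"
proof -
  from assms(1) obtain a b where ab: "a < b" "I \<in> sets lebesgue"
    "emeasure lebesgue I = ennreal (b - a)"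
    using bounded_intervals_bounds by metis
  have "weight_of v I \<le> ennreal c * ennreal (b - a)"
    using weight_of_mono[of I v "\<lambda>_. c" I] weight_of_const[of I c] ab assms(2) by simp
  then have "weight_of v I / ennreal (b - a) \<le> ennreal c * ennreal (b - a) / ennreal (b - a)"
    by (rule divide_right_mono_ennreal)
  then show ?thesis using ab by (simp add: ennreal_mult_divide_eq)
qed

lemma ennreal_powr_mono:
  assumes "0 < a" "x \<le> y" shows "ennreal_powr x a \<le> ennreal_powr y a"
  using assms unfolding ennreal_powr_def
  by (auto simp: top_unique less_top[symmetric] intro!: ennreal_leI powr_mono2 enn2real_mono)

lemma ennreal_powr_ennreal: "0 \<le> x \<Longrightarrow> ennreal_powr (ennreal x) a = ennreal (x powr a)"
  by (simp add: ennreal_powr_def)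

text \<open>The growth \<open>1 / d\<close> comes from the average of the weight; the essential supremum of its reciprocal
is at most \<open>R powr (1 - d)\<close>. The point 0, where the reciprocal is infinite, is a null set.\<close>

lemma A_const_1_abs_powr_upper:
  assumes d: "0 < d" "d \<le> 1"
  shows "A_const 1 (\<lambda>x. \<bar>x\<bar> powr (d - 1)) \<le> ennreal (4 / d)"
  unfolding A_const_def if_P[OF refl]
proof (rule SUP_least)
  fix I assume I: "I \<in> bounded_intervals"
  obtain R where R: "0 < R" "\<And>x. x \<in> I \<Longrightarrow> \<bar>x\<bar> \<le> R"
    and av: "weight_of (\<lambda>x. \<bar>x\<bar> powr (d - 1)) I / emeasure lebesgue I \<le> ennreal (4 / d * R powr (d - 1))"
    using average_abs_powr_le[OF I] d by metis
  have [measurable]: "I \<in> sets lebesgue" using I bounded_intervals_bounds by metis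
  have "esssup (lebesgue_on I) (\<lambda>x. inverse (ennreal (\<bar>x\<bar> powr (d - 1)))) \<le> ennreal (R powr (1 - d))"
  proof (rule esssup_I)
    have "(\<lambda>x::real. inverse (ennreal (\<bar>x\<bar> powr (d - 1)))) \<in> borel_measurable lebesgue"
      by (intro measurable_completion) measurable
    then show "(\<lambda>x. inverse (ennreal (\<bar>x\<bar> powr (d - 1)))) \<in> borel_measurable (lebesgue_on I)"
      by (rule measurable_restrict_space1)
    have "inverse (ennreal (\<bar>x\<bar> powr (d - 1))) \<le> ennreal (R powr (1 - d))" if "x \<noteq> 0" "x \<in> I" for x
    proof -
      have "inverse (ennreal (\<bar>x\<bar> powr (d - 1))) = ennreal (\<bar>x\<bar> powr (1 - d))"
        using that by (subst inverse_ennreal) (auto simp flip: powr_minus)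
      also have "\<dots> \<le> ennreal (R powr (1 - d))"
        using R that d by (intro ennreal_leI powr_mono2) auto
      finally show ?thesis .
    qed
    then show "AE x in lebesgue_on I. inverse (ennreal (\<bar>x\<bar> powr (d - 1))) \<le> ennreal (R powr (1 - d))"
      using AE_lebesgue_nonzero by (auto simp: AE_restrict_space_iff)
  qed
  with av have "weight_of (\<lambda>x. \<bar>x\<bar> powr (d - 1)) I / emeasure lebesgue I
      * esssup (lebesgue_on I) (\<lambda>x. inverse (ennreal (\<bar>x\<bar> powr (d - 1))))
      \<le> ennreal (4 / d * R powr (d - 1)) * ennreal (R powr (1 - d))"
    by (intro mult_mono) auto
  also have "\<dots> = ennreal (4 / d)"
    using R d by (simp add: powr_diff flip: ennreal_mult)
  finally show "weight_of (\<lambda>x. \<bar>x\<bar> powr (d - 1)) I / emeasure lebesgue I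
      * esssup (lebesgue_on I) (\<lambda>x. inverse (ennreal (\<bar>x\<bar> powr (d - 1)))) \<le> ennreal (4 / d)" .
qed

text \<open>A bound below that is uniform in \<open>d\<close> controls negative powers of the constant. On \<open>{1..2}\<close> the
weight lies between \<open>1 / 2\<close> and 1.\<close>

lemma A_const_1_abs_powr_lower:
  assumes d: "0 < d" "d \<le> 1"
  shows "ennreal (1 / 2) \<le> A_const 1 (\<lambda>x. \<bar>x\<bar> powr (d - 1))"
proof -
  let ?v = "\<lambda>x::real. \<bar>x\<bar> powr (d - 1)"
  have I: "{1..2} \<in> bounded_intervals" by (simp add: atLeastAtMost_in_bounded_intervals)
  have "1 / 2 \<le> ?v x" if "x \<in> {1..2}" for x
  proof -
    have "2 powr (- 1) \<le> (2::real) powr (d - 1)" using d by (intro powr_mono) auto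
    also have "\<dots> \<le> ?v x" using that d by (intro powr_mono2') auto
    finally show ?thesis by (simp add: powr_minus)
  qed
  then have av: "ennreal (1 / 2) \<le> weight_of ?v {1..2} / emeasure lebesgue {1..2::real}"
    by (rule average_ge[OF I])
  have le: "1 \<le> inverse (ennreal (?v x))" if "x \<in> {1..2}" for x
  proof -
    have "?v x \<le> ?v 1" using that d by (intro powr_mono2') auto
    then show ?thesis using that by (simp add: inverse_ennreal field_simps flip: ennreal_1)
  qed
  have "1 \<le> esssup (lebesgue_on {1..2}) (\<lambda>x. inverse (ennreal (?v x)))"
  proof -
    have "AE x in lebesgue_on {1..2::real}. 1 \<le> esssup (lebesgue_on {1..2}) (\<lambda>x. inverse (ennreal (?v x)))"
      using esssup_AE[where M = "lebesgue_on {1..2}" and f = "\<lambda>x. inverse (ennreal (?v x))"] AE_space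
      by eventually_elim (use le in \<open>auto simp: space_restrict_space intro: order_trans\<close>)
    moreover have "ae_filter (lebesgue_on {1..2::real}) \<noteq> bot"
      by (simp add: ae_filter_eq_bot_iff space_restrict_space emeasure_restrict_space)
    ultimately show ?thesis using eventually_const by blast
  qed
  with av have "ennreal (1 / 2) * 1 \<le> weight_of ?v {1..2} / emeasure lebesgue {1..2::real}
      * esssup (lebesgue_on {1..2}) (\<lambda>x. inverse (ennreal (?v x)))"
    by (intro mult_mono) auto
  then show ?thesis
    unfolding A_const_def using I by (auto intro: SUP_upper2)
qed

text \<open>The exponent \<open>(p - 1) * (1 - d)\<close> is the one whose dual weight is \<open>|x| powr (d - 1)\<close>, at distance
\<open>d\<close> from failing to be locally integrable.\<close>

lemma A_const_p_dual:
  assumes "I \<in> sets lebesgue" "1 < p"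
  shows "(\<integral>\<^sup>+x\<in>I. inverse (ennreal ((\<bar>x\<bar> powr ((p - 1) * (1 - d))) powr (1 / (p - 1)))) \<partial>lebesgue)
    = weight_of (\<lambda>x. \<bar>x\<bar> powr (d - 1)) I"
  unfolding weight_of_def
proof (rule nn_integral_cong_AE)
  have "inverse (ennreal ((\<bar>x\<bar> powr ((p - 1) * (1 - d))) powr (1 / (p - 1)))) = ennreal (\<bar>x\<bar> powr (d - 1))"
    if "x \<noteq> 0" for x
    using that assms by (simp add: powr_powr inverse_ennreal flip: powr_minus)
  then show "AE x in lebesgue. inverse (ennreal ((\<bar>x\<bar> powr ((p - 1) * (1 - d))) powr (1 / (p - 1)))) * indicator I x
      = ennreal (\<bar>x\<bar> powr (d - 1)) * indicator I x"
    using AE_lebesgue_nonzero by (auto elim: eventually_mono)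
qed

text \<open>Here the primal average stays bounded after scaling and the dual average contributes \<open>4 / d\<close>, which
the power \<open>p - 1\<close> turns into the asserted growth.\<close>

lemma A_const_p_abs_powr_upper:
  assumes d: "0 < d" "d \<le> 1" and p: "1 < p"
  shows "A_const p (\<lambda>x. \<bar>x\<bar> powr ((p - 1) * (1 - d))) \<le> ennreal ((4 / d) powr (p - 1))"
proof -
  let ?v = "\<lambda>x. \<bar>x\<bar> powr ((p - 1) * (1 - d))"
  have "weight_of ?v I / emeasure lebesgue I
           * ennreal_powr (weight_of (\<lambda>x. \<bar>x\<bar> powr (d - 1)) I / emeasure lebesgue I) (p - 1)
        \<le> ennreal ((4 / d) powr (p - 1))" if I: "I \<in> bounded_intervals" for I
  proof -
    obtain R where R: "0 < R" "\<And>x. x \<in> I \<Longrightarrow> \<bar>x\<bar> \<le> R"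
      and av: "weight_of (\<lambda>x. \<bar>x\<bar> powr (d - 1)) I / emeasure lebesgue I \<le> ennreal (4 / d * R powr (d - 1))"
      using average_abs_powr_le[OF I] d by metis
    have "weight_of ?v I / emeasure lebesgue I \<le> ennreal (R powr ((p - 1) * (1 - d)))"
      using R p d by (intro average_le[OF I] powr_mono2) auto
    moreover have "ennreal_powr (weight_of (\<lambda>x. \<bar>x\<bar> powr (d - 1)) I / emeasure lebesgue I) (p - 1)
        \<le> ennreal ((4 / d * R powr (d - 1)) powr (p - 1))"
      using ennreal_powr_mono[OF _ av, of "p - 1"] p d by (simp add: ennreal_powr_ennreal)
    ultimately have "weight_of ?v I / emeasure lebesgue I
           * ennreal_powr (weight_of (\<lambda>x. \<bar>x\<bar> powr (d - 1)) I / emeasure lebesgue I) (p - 1)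
        \<le> ennreal (R powr ((p - 1) * (1 - d))) * ennreal ((4 / d * R powr (d - 1)) powr (p - 1))"
      by (intro mult_mono) auto
    also have "\<dots> = ennreal (R powr ((p - 1) * (1 - d)) * (4 / d * R powr (d - 1)) powr (p - 1))"
      by (simp add: ennreal_mult)
    also have "R powr ((p - 1) * (1 - d)) * (4 / d * R powr (d - 1)) powr (p - 1)
        = (4 / d) powr (p - 1) * (R powr ((p - 1) * (1 - d)) * R powr ((d - 1) * (p - 1)))"
      using d R by (simp add: powr_mult powr_powr powr_divide)
    also have "R powr ((p - 1) * (1 - d)) * R powr ((d - 1) * (p - 1)) = 1"
      using R by (simp add: algebra_simps flip: powr_add)
    finally show ?thesis by simp
  qed
  moreover have "I \<in> sets lebesgue" if "I \<in> bounded_intervals" for I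
    using that bounded_intervals_bounds by metis
  moreover have "p \<noteq> 1" using p by simp
  ultimately show ?thesis
    unfolding A_const_def if_not_P[OF \<open>p \<noteq> 1\<close>] by (intro SUP_least) (simp only: A_const_p_dual[OF _ p])
qed

lemma A_const_p_abs_powr_lower:
  assumes d: "0 < d" "d \<le> 1" and p: "1 < p"
  shows "ennreal ((1 / 2) powr (p - 1)) \<le> A_const p (\<lambda>x. \<bar>x\<bar> powr ((p - 1) * (1 - d)))"
proof -
  let ?v = "\<lambda>x. \<bar>x\<bar> powr ((p - 1) * (1 - d))"
  have I: "{1..2} \<in> bounded_intervals" by (simp add: atLeastAtMost_in_bounded_intervals)
  have "1 / 2 \<le> \<bar>x\<bar> powr (d - 1)" if "x \<in> {1..2}" for x
  proof -
    have "2 powr (- 1) \<le> (2::real) powr (d - 1)" using d by (intro powr_mono) auto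
    also have "\<dots> \<le> \<bar>x\<bar> powr (d - 1)" using that d by (intro powr_mono2') auto
    finally show ?thesis by (simp add: powr_minus)
  qed
  then have "ennreal (1 / 2) \<le> weight_of (\<lambda>x. \<bar>x\<bar> powr (d - 1)) {1..2} / emeasure lebesgue {1..2::real}"
    by (rule average_ge[OF I])
  then have "ennreal ((1 / 2) powr (p - 1))
      \<le> ennreal_powr (weight_of (\<lambda>x. \<bar>x\<bar> powr (d - 1)) {1..2} / emeasure lebesgue {1..2::real}) (p - 1)"
    using ennreal_powr_mono[of "p - 1" "ennreal (1 / 2)"] p by (simp add: ennreal_powr_ennreal del: ennreal_half)
  moreover have "ennreal 1 \<le> weight_of ?v {1..2} / emeasure lebesgue {1..2::real}"
    using d p by (intro average_ge[OF I]) (auto intro!: ge_one_powr_ge_zero)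
  ultimately have "ennreal 1 * ennreal ((1 / 2) powr (p - 1)) \<le> weight_of ?v {1..2} / emeasure lebesgue {1..2::real}
     * ennreal_powr (weight_of (\<lambda>x. \<bar>x\<bar> powr (d - 1)) {1..2} / emeasure lebesgue {1..2::real}) (p - 1)"
    by (intro mult_mono) auto
  then show ?thesis
    unfolding A_const_def using I p by (auto intro!: SUP_upper2[OF I] simp: A_const_p_dual[OF _ p])
qed

section \<open>From test functions to a bound on the exponent\<close>

lemma weighted_norm_powr:
  assumes "0 < p"
  shows "ennreal_powr (weighted_norm p v g) p = (\<integral>\<^sup>+x. ennreal (\<bar>g x\<bar> powr p * v x) \<partial>lebesgue)"
  using assms unfolding weighted_norm_def ennreal_powr_def by (auto simp: powr_powr ennreal_enn2real less_top)

lemma in_sobolevI: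
  assumes "has_weak_derivative f g" "(\<integral>\<^sup>+x. ennreal (\<bar>g x\<bar> powr p * v x) \<partial>lebesgue) < \<infinity>"
  shows "f \<in> sobolev p v"
proof -
  have "weighted_norm p v g < \<infinity>"
    using assms(2) unfolding weighted_norm_def ennreal_powr_def by auto
  then show ?thesis using assms(1) unfolding sobolev_def has_weak_derivative_def by auto
qed

abbreviation (input) level_sup ::
    "real \<Rightarrow> real \<Rightarrow> real \<Rightarrow> real \<Rightarrow> (real \<Rightarrow> real) \<Rightarrow> (real \<Rightarrow> real) \<Rightarrow> ennreal" where
  "level_sup p \<alpha> b e v f \<equiv> (SUP l\<in>{0<..}. ennreal (l powr p) *
     (\<Sum>\<^sub>\<infinity>I\<in>dyadic_level \<alpha> l b f. ennreal (measure lebesgue I powr e) * weight_of v I))"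

lemma level_sum_ge:
  assumes "0 < l" "finite F" "F \<subseteq> dyadic_level \<alpha> l b f"
    and "\<And>I. I \<in> F \<Longrightarrow> c \<le> ennreal (measure lebesgue I powr e) * weight_of v I"
  shows "ennreal (l powr p) * (of_nat (card F) * c)
    \<le> level_sup p \<alpha> b e v f"
proof (rule SUP_upper2)
  show "l \<in> {0<..}" using assms(1) by simp
  let ?T = "\<lambda>I. ennreal (measure lebesgue I powr e) * weight_of v I"
  have "of_nat (card F) * c \<le> sum ?T F"
    using assms(4) by (rule sum_bounded_below)
  also have "sum ?T F = infsum ?T F" using assms(2) by simp
  also have "\<dots> \<le> infsum ?T (dyadic_level \<alpha> l b f)"
    using assms(3) by (intro infsum_mono_neutral nonneg_summable_on_complete) auto
  finally show "ennreal (l powr p) * (of_nat (card F) * c)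
    \<le> ennreal (l powr p) * infsum ?T (dyadic_level \<alpha> l b f)"
    by (rule mult_left_mono) simp
qed

text \<open>If \<open>s > q * max \<gamma> 0\<close>, then \<open>K \<le> M' * d powr (s - q * max \<gamma> 0)\<close> for small \<open>d\<close>, which fails as \<open>d\<close>
tends to 0. The maximum handles negative \<open>\<gamma>\<close>, for which the lower bound \<open>c\<close> on \<open>A\<close> makes
\<open>A powr \<gamma>\<close> bounded; as \<open>s\<close> is positive, that case is contradictory as well.\<close>

lemma exponent_comparison:
  fixes K M c q s \<gamma> d0 :: real
  assumes "0 < K" "0 < d0" "0 < c" "0 \<le> M" "0 < s" "0 \<le> q"
    and bound: "\<And>d. 0 < d \<Longrightarrow> d < d0 \<Longrightarrow>
      \<exists>A. c \<le> A \<and> A \<le> (4 / d) powr q \<and> K * d powr (- s) \<le> M * A powr \<gamma>"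
  shows "s \<le> q * \<gamma>"
proof (rule ccontr)
  assume "\<not> s \<le> q * \<gamma>"
  define t where "t = q * max \<gamma> 0"
  have st: "0 < s - t"
    using \<open>\<not> s \<le> q * \<gamma>\<close> \<open>0 < s\<close> by (auto simp: t_def max_def)
  define M' where "M' = M * max (c powr \<gamma>) (4 powr t)"
  have le: "K \<le> M' * d powr (s - t)" if d: "0 < d" "d < d0" "d < 1" for d
  proof -
    obtain A where A: "c \<le> A" "A \<le> (4 / d) powr q" "K * d powr (- s) \<le> M * A powr \<gamma>"
      using bound d by blast
    have "A powr \<gamma> \<le> max (c powr \<gamma>) (4 powr t) * d powr (- t)"
    proof (cases "\<gamma> < 0")
      case True
      have "A powr \<gamma> \<le> c powr \<gamma>" using A(1) True \<open>0 < c\<close> by (intro powr_mono2') auto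
      then show ?thesis using True d by (simp add: t_def)
    next
      case False
      have "A powr \<gamma> \<le> ((4 / d) powr q) powr \<gamma>"
        using A \<open>0 < c\<close> False by (intro powr_mono2) auto
      also have "\<dots> = 4 powr t * d powr (- t)"
        using False d by (simp add: t_def powr_powr powr_divide powr_minus_divide)
      also have "\<dots> \<le> max (c powr \<gamma>) (4 powr t) * d powr (- t)"
        by (intro mult_right_mono) auto
      finally show ?thesis .
    qed
    then have "K * d powr (- s) \<le> M' * d powr (- t)"
      using A(3) mult_left_mono[OF _ \<open>0 \<le> M\<close>] unfolding M'_def by (fastforce simp: mult.assoc)
    then have "K * d powr (- s) * d powr s \<le> M' * d powr (- t) * d powr s"
      by (intro mult_right_mono) auto
    then show ?thesis using d by (simp add: mult.assoc flip: powr_add)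
  qed
  have "((\<lambda>d. M' * d powr (s - t)) \<longlongrightarrow> M' * 0 powr (s - t)) (at_right 0)"
    using st by (intro tendsto_intros tendsto_powr') (auto simp: eventually_at_filter)
  moreover have "eventually (\<lambda>d. K \<le> M' * d powr (s - t)) (at_right 0)"
    using le \<open>0 < d0\<close> by (intro eventually_at_rightI[of 0 "min d0 1"]) auto
  ultimately have "K \<le> M' * 0 powr (s - t)"
    by (intro tendsto_lowerbound) auto
  then show False using \<open>0 < K\<close> by simp
qed

lemma enn2real_bounds:
  assumes "ennreal a \<le> X" "X \<le> ennreal b" "0 \<le> b"
  shows "a \<le> enn2real X" "enn2real X \<le> b" "X < \<infinity>"
proof -
  show *: "X < \<infinity>" using assms(2) by (simp add: le_less_trans)
  show "enn2real X \<le> b" using assms by (simp add: enn2real_leI)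
  show "a \<le> enn2real X" using assms(1) * by (cases X) (auto simp: ennreal_le_iff2)
qed

section \<open>The test function for the class of exponent one\<close>

text \<open>The derivative of \<open>f\<close> lives on \<open>[1/2, 1]\<close>, away from the singularity, where the weight is at most 2,
while the weight of \<open>[0, 1)\<close> is about \<open>1 / d\<close>. This interval alone gives the lower bound. Its length is
1, so the exponents \<open>b\<close> and \<open>e\<close> are arbitrary.\<close>

lemma ramp_test:
  fixes d p b e :: real
  assumes d: "0 < d" "d \<le> 1" and p: "0 < p"
  defines "v \<equiv> \<lambda>x. \<bar>x\<bar> powr (d - 1)"
  shows "\<exists>f g. f \<in> sobolev p v \<and> has_weak_derivative f g \<and> ennreal_powr (weighted_norm p v g) p \<le> 1 \<and>
    ennreal ((1 / 33) powr p / (2 * d)) \<le> level_sup p 0 b e v f"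
proof -
  define f :: "real \<Rightarrow> real" where "f x = max 0 (min (x - 1 / 2) (1 / 2))" for x
  define g :: "real \<Rightarrow> real" where "g = indicator {1/2..1}"
  have cf: "continuous_on A f" for A unfolding f_def by (intro continuous_intros)
  have lg: "locally_integrable g"
  proof (rule locally_integrable_if_weight_finite)
    fix r :: real
    have "weight_of (\<lambda>x. \<bar>g x\<bar>) {- r..r} \<le> weight_of (\<lambda>x. 1) {- r..r}"
      by (intro weight_of_mono) (auto simp: g_def indicator_def)
    also have "\<dots> < \<infinity>" by (simp add: weight_of_const emeasure_lborel_Icc_eq ennreal_mult_less_top)
    finally show "weight_of (\<lambda>x. \<bar>g x\<bar>) {- r..r} < \<infinity>" .
  qed (simp add: g_def)
  have wd: "has_weak_derivative f g"
  proof (rule has_weak_derivative_if_piecewise[of "{1/2, 1}"])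
    fix x :: real assume x: "x \<notin> {1/2, 1}"
    consider "x < 1/2" | "1/2 < x" "x < 1" | "1 < x" using x by fastforce
    then show "(f has_real_derivative g x) (at x)"
    proof cases
      case 1
      have "((\<lambda>x. 0) has_real_derivative g x) (at x)" using 1 by (simp add: g_def)
      then show ?thesis
        by (rule has_field_derivative_transform_within_open[of _ _ _ "{..<1/2}"]) (use 1 in \<open>auto simp: f_def\<close>)
    next
      case 2
      have "((\<lambda>x. x - 1/2) has_real_derivative g x) (at x)"
        using 2 by (auto simp: g_def intro!: derivative_eq_intros)
      then show ?thesis
        by (rule has_field_derivative_transform_within_open[of _ _ _ "{1/2<..<1}"]) (use 2 in \<open>auto simp: f_def\<close>)
    next
      case 3
      have "((\<lambda>x. 1/2) has_real_derivative g x) (at x)" using 3 by (simp add: g_def)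
      then show ?thesis
        by (rule has_field_derivative_transform_within_open[of _ _ _ "{1<..}"]) (use 3 in \<open>auto simp: f_def\<close>)
    qed
  qed (use cf lg in auto)
  have norm: "(\<integral>\<^sup>+x. ennreal (\<bar>g x\<bar> powr p * v x) \<partial>lebesgue) \<le> 1"
  proof -
    have le: "v x \<le> 2" if "x \<in> {1/2..1}" for x
    proof -
      have "v x \<le> (1/2) powr (d - 1)" unfolding v_def using that d by (intro powr_mono2') auto
      also have "\<dots> = 2 powr (1 - d)" by (simp add: powr_divide powr_diff)
      also have "\<dots> \<le> 2 powr (1::real)" using d by (intro powr_mono) auto
      finally show ?thesis by simp
    qed
    have "(\<integral>\<^sup>+x. ennreal (\<bar>g x\<bar> powr p * v x) \<partial>lebesgue) \<le> weight_of (\<lambda>x. 2) {1/2..1}"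
      unfolding weight_of_def
      by (intro nn_integral_mono) (use ennreal_leI[OF le] in \<open>simp add: g_def indicator_def\<close>)
    also have "\<dots> = ennreal 1" 
      using ennreal_mult[of 2 "1/2"] by (simp add: weight_of_const)
    finally show ?thesis by simp
  qed
  let ?I = "{0..<1::real}"
  have dyad: "?I \<in> shifted_dyadic 0"
    unfolding shifted_dyadic_def by (auto intro!: exI[of _ 0])
  \<comment> \<open>On \<open>[0, 1/2]\<close> the function vanishes, and on \<open>[3/4, 1)\<close> it is at least \<open>1 / 4\<close>. This gives an oscillation of
    at least \<open>1 / 32\<close>, so the level \<open>1 / 33\<close> is exceeded.\<close>
  have "1/4 * measure lebesgue {0..1/2::real} * measure lebesgue {3/4..<1::real} / (measure lebesgue ?I)\<^sup>2
      \<le> oscillation ?I f"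
    by (intro oscillation_ge cf) (auto simp: f_def)
  then have "1 / 32 \<le> oscillation ?I f" by simp
  then have lev: "{?I} \<subseteq> dyadic_level 0 (1/33) b f"
    using dyad by (simp add: dyadic_level_def)
  have w: "ennreal (1 / (2 * d)) \<le> weight_of v ?I"
  proof -
    have "(1/2) powr 1 \<le> (1/2::real) powr d" using d by (intro powr_mono') auto
    then have "1 / (2 * d) \<le> (1/2) powr d / d" using d by (simp add: field_simps)
    then have "ennreal (1 / (2 * d)) \<le> weight_of v {0..1/2}"
      unfolding v_def using d by (subst weight_of_abs_powr_Icc) (auto intro: ennreal_leI)
    also have "\<dots> \<le> weight_of v ?I" by (intro weight_of_mono) auto
    finally show ?thesis .
  qed
  have "ennreal ((1 / 33) powr p / (2 * d)) = ennreal ((1/33) powr p) * (of_nat (card {?I}) * ennreal (1 / (2 * d)))"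
    using d by (simp flip: ennreal_mult)
  also have "\<dots> \<le> level_sup p 0 b e v f"
    using lev w by (intro level_sum_ge) auto
  finally have lower: "ennreal ((1 / 33) powr p / (2 * d)) \<le> level_sup p 0 b e v f" .
  have "f \<in> sobolev p v" using wd norm by (intro in_sobolevI) (auto intro: le_less_trans)
  with wd norm lower show ?thesis unfolding weighted_norm_powr[OF p] by blast
qed

section \<open>The test function for exponents larger than one\<close>

text \<open>The intervals of \<open>shifted_dyadic (1/3)\<close> at the even scales \<open>- 2 k\<close> and translation \<open>- 1\<close>. In
contrast to the unshifted dyadic intervals, they have 0 in their interior, one third of the way
from the right end.\<close>

definition origin_interval :: "nat \<Rightarrow> real set" where
  "origin_interval k = {- 2/3 * (1/4) ^ k..<1/3 * (1/4) ^ k}"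

lemma measure_origin_interval: "measure lebesgue (origin_interval k) = (1/4) ^ k"
  by (simp add: origin_interval_def)

lemma origin_interval_dyadic: "origin_interval k \<in> shifted_dyadic (1/3)"
proof -
  define r :: real where "r = (1/4) ^ k"
  have r: "0 < r" by (simp add: r_def)
  have "2 powi (- 2 * int k) = ((2::real) powi (- 2)) powi int k" by (rule power_int_mult)
  also have "(2::real) powi (- 2) = 1/4" by (simp add: power_int_minus)
  finally have two: "2 powi (- 2 * int k) = r" by (simp add: r_def)
  have one: "(- 1) powi (- 2 * int k) = (1 :: real)"
    by (simp add: power_int_minus)
  have "origin_interval k = (\<lambda>t. r * (of_int (- 1) + t + 1 * (1/3))) ` {0..<1}"
  proof (intro equalityI subsetI)
    fix x assume "x \<in> origin_interval k"
    then have "x / r + 2/3 \<in> {0..<1}" "x = r * (of_int (- 1) + (x / r + 2/3) + 1 * (1/3))"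
      using r unfolding origin_interval_def r_def[symmetric] by (auto simp: field_simps)
    then show "x \<in> (\<lambda>t. r * (of_int (- 1) + t + 1 * (1/3))) ` {0..<1}" by blast
  next
    fix x assume "x \<in> (\<lambda>t. r * (of_int (- 1) + t + 1 * (1/3))) ` {0..<1}"
    then obtain t where t: "0 \<le> t" "t < 1" "x = r * (t - 2/3)" by auto
    have "r * (- 2/3) \<le> r * (t - 2/3)" "r * (t - 2/3) < r * (1/3)"
      using r t by (intro mult_left_mono mult_strict_left_mono; simp)+
    then show "x \<in> origin_interval k" 
      using t by (auto simp: origin_interval_def r_def[symmetric] mult.commute)
  qed
  then have "origin_interval k = (\<lambda>t. 2 powi (- 2 * int k) *
      (of_int (- 1) + t + (- 1) powi (- 2 * int k) * (1/3))) ` {0..<1}"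
    unfolding two one .
  then show ?thesis unfolding shifted_dyadic_def by blast
qed

text \<open>The test function \<open>f\<close> is 0 on the negative half-line and rises like \<open>x powr d\<close> from 0 to 1 on
\<open>[0, 1]\<close>. Down to the scale \<open>4 powr (- 1 / d)\<close> the value \<open>x powr d\<close> stays comparable to 1, so \<open>f\<close>
looks like a unit jump and its oscillation over every \<open>origin_interval k\<close> with \<open>k \<le> 1 / d\<close> exceeds
one fixed level. Each of these roughly \<open>1 / d\<close> intervals contributes a fixed amount to the sum: its
summand is comparable to \<open>|I| powr (p * b - (p - 1) * d)\<close>, an exponent of size at most \<open>p * d\<close>. The
hypothesis \<open>b \<le> d\<close> serves exactly this. On the other side, \<open>|f'| powr p * v\<close> collapses to
\<open>d powr p * x powr (d - 1)\<close>, whose integral over \<open>[0, 1]\<close> is \<open>d powr (p - 1)\<close>.\<close>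

lemma truncated_power_test:
  fixes d p b :: real
  assumes d: "0 < d" "d \<le> 1" and p: "1 < p" and b: "0 \<le> b" "b \<le> d"
  defines "v \<equiv> \<lambda>x. \<bar>x\<bar> powr ((p - 1) * (1 - d))"
  shows "\<exists>f g. f \<in> sobolev p v \<and> has_weak_derivative f g \<and>
    ennreal_powr (weighted_norm p v g) p \<le> ennreal (d powr (p - 1)) \<and>
    ennreal ((1 / 217) powr p * ((1/12) powr p / d)) \<le> level_sup p (1/3) b (p * b - p) v f"
proof -
  define f :: "real \<Rightarrow> real" where "f x = (max 0 (min x 1)) powr d" for x
  define g :: "real \<Rightarrow> real" where "g x = (if 0 < x \<and> x < 1 then d * x powr (d - 1) else 0)" for x
  have cf: "continuous_on A f" for A
    unfolding f_def using d by (intro continuous_on_powr' continuous_intros) auto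
  have lg: "locally_integrable g"
  proof (rule locally_integrable_if_weight_finite)
    fix r :: real assume "0 \<le> r"
    have "weight_of (\<lambda>x. \<bar>g x\<bar>) {- r..r} \<le> weight_of (\<lambda>x. \<bar>x\<bar> powr (d - 1)) {- r..r}"
      using d by (intro weight_of_mono) (auto simp: g_def abs_mult intro!: mult_left_le_one_le)
    also have "\<dots> < \<infinity>" using \<open>0 \<le> r\<close> d by (simp add: weight_of_abs_powr_symmetric)
    finally show "weight_of (\<lambda>x. \<bar>g x\<bar>) {- r..r} < \<infinity>" .
  qed (unfold g_def, measurable)
  have wd: "has_weak_derivative f g"
  proof (rule has_weak_derivative_if_piecewise[of "{0, 1}"])
    fix x :: real assume x: "x \<notin> {0, 1}"
    consider "x < 0" | "0 < x" "x < 1" | "1 < x" using x by fastforce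
    then show "(f has_real_derivative g x) (at x)"
    proof cases
      case 1
      have "((\<lambda>x. 0) has_real_derivative g x) (at x)" using 1 by (simp add: g_def)
      then show ?thesis
        by (rule has_field_derivative_transform_within_open[of _ _ _ "{..<0}"]) (use 1 in \<open>auto simp: f_def\<close>)
    next
      case 2
      have "((\<lambda>x. x powr d) has_real_derivative g x) (at x)"
        using 2 by (auto simp: g_def intro!: derivative_eq_intros)
      then show ?thesis
        by (rule has_field_derivative_transform_within_open[of _ _ _ "{0<..<1}"]) (use 2 in \<open>auto simp: f_def\<close>)
    next
      case 3
      have "((\<lambda>x. 1) has_real_derivative g x) (at x)" using 3 by (simp add: g_def)
      then show ?thesis
        by (rule has_field_derivative_transform_within_open[of _ _ _ "{1<..}"]) (use 3 in \<open>auto simp: f_def\<close>)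
    qed
  qed (use cf lg in auto)
  have norm: "(\<integral>\<^sup>+x. ennreal (\<bar>g x\<bar> powr p * v x) \<partial>lebesgue) \<le> ennreal (d powr (p - 1))"
  proof -
    have "ennreal (\<bar>g x\<bar> powr p * v x) \<le> ennreal (d powr p * \<bar>x\<bar> powr (d - 1)) * indicator {0..1} x" for x
    proof (cases "0 < x \<and> x < 1")
      case True
      have "\<bar>g x\<bar> powr p * v x = d powr p * (x powr ((d - 1) * p) * x powr ((p - 1) * (1 - d)))"
        using True d by (simp add: g_def v_def abs_mult powr_mult powr_powr)
      also have "x powr ((d - 1) * p) * x powr ((p - 1) * (1 - d)) = x powr (d - 1)"
        using True by (simp add: algebra_simps flip: powr_add)
      finally show ?thesis using True by simp
    next
      case False
      then have "g x = 0" unfolding g_def by (rule if_not_P)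
      then show ?thesis using p by simp
    qed
    then have "(\<integral>\<^sup>+x. ennreal (\<bar>g x\<bar> powr p * v x) \<partial>lebesgue)
        \<le> (\<integral>\<^sup>+x. ennreal (d powr p * \<bar>x\<bar> powr (d - 1)) * indicator {0..1} x \<partial>lebesgue)"
      by (intro nn_integral_mono) auto
    also have "\<dots> = (\<integral>\<^sup>+x. ennreal (d powr p) * (ennreal (\<bar>x\<bar> powr (d - 1)) * indicator {0..1} x) \<partial>lborel)"
      by (simp add: nn_integral_completion ennreal_mult mult.assoc)
    also have "\<dots> = ennreal (d powr p) * weight_of (\<lambda>x. \<bar>x\<bar> powr (d - 1)) {0..1}"
      unfolding weight_of_def nn_integral_completion by (intro nn_integral_cmult) measurable
    also have "\<dots> = ennreal (d powr (p - 1))"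
      unfolding weight_of_abs_powr_Icc[OF d(1) zero_le_one] using d by (simp add: powr_diff flip: ennreal_mult)
    finally show ?thesis .
  qed
  have term_bounds: "origin_interval k \<in> dyadic_level (1/3) (1/217) b f \<and>
      ennreal ((1/12) powr p) \<le> ennreal (measure lebesgue (origin_interval k) powr (p * b - p)) * weight_of v (origin_interval k)"
    if k: "real k * d \<le> 1" for k
  proof
    define r :: real where "r = (1/4) ^ k"
    have r: "0 < r" "r \<le> 1" by (auto simp: r_def power_le_one)
    have I: "origin_interval k = {- 2/3 * r..<1/3 * r}" by (simp add: origin_interval_def r_def)
    have "r powr d = (1/4) powr (real k * d)"
      unfolding r_def by (simp add: powr_powr flip: powr_realpow)
    also have "\<dots> \<ge> (1/4) powr 1" using k by (intro powr_mono') auto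
    finally have rd: "1/4 \<le> r powr d" by simp
    have jump: "1/24 \<le> \<bar>f x - f y\<bar>" if "x \<in> {- 2/3 * r..0}" "y \<in> {r/6..<r/3}" for x y
    proof -
      have "(1/6) powr 1 \<le> (1/6::real) powr d" using d by (intro powr_mono') auto
      then have "1/4 * (1/6) \<le> r powr d * (1/6) powr d" using rd by (intro mult_mono) auto
      also have "\<dots> = (r/6) powr d" using r by (simp add: powr_divide)
      also have "\<dots> \<le> y powr d" using that r d by (intro powr_mono2) auto
      also have "y powr d = f y" using that r by (simp add: f_def)
      finally show ?thesis using that by (simp add: f_def)
    qed
    \<comment> \<open>The two sets fill the fractions \<open>2 / 3\<close> and \<open>1 / 6\<close> of the interval, and \<open>f\<close> jumps by \<open>1 / 24\<close>
      between them; hence the bound \<open>1 / 216\<close> and the level \<open>1 / 217\<close>.\<close>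
    have "1/24 * measure lebesgue {- 2/3 * r..0} * measure lebesgue {r/6..<r/3} / (measure lebesgue (origin_interval k))\<^sup>2
        \<le> oscillation (origin_interval k) f"
      using r by (intro oscillation_ge cf jump) (auto simp: I)
    then have osc: "1 / 216 \<le> oscillation (origin_interval k) f"
      using r by (simp add: I power2_eq_square field_simps)
    have "r powr b \<le> 1" using r b by (intro powr_le1) auto
    with osc show "origin_interval k \<in> dyadic_level (1/3) (1/217) b f"
      using origin_interval_dyadic unfolding dyadic_level_def by (auto simp: measure_origin_interval r_def)
    \<comment> \<open>The left half of the negative part, of length \<open>r / 3\<close>, stays at distance at least \<open>r / 3\<close> from 0.\<close>
    have w: "ennreal ((r/3) powr ((p - 1) * (1 - d)) * (r/3)) \<le> weight_of v (origin_interval k)"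
    proof -
      have "weight_of (\<lambda>x. (r/3) powr ((p - 1) * (1 - d))) {- 2/3 * r..- 1/3 * r} \<le> weight_of v (origin_interval k)"
        unfolding v_def I using r d p by (intro weight_of_mono powr_mono2) auto
      moreover have "ennreal ((r/3) powr ((p - 1) * (1 - d)) * (r/3))
          = weight_of (\<lambda>x. (r/3) powr ((p - 1) * (1 - d))) {- 2/3 * r..- 1/3 * r}"
        using r ennreal_mult[of "(r/3) powr ((p - 1) * (1 - d))" "r/3"] by (simp add: weight_of_const)
      ultimately show ?thesis by simp
    qed
    have "(1/12) powr p \<le> r powr (p * b - p) * ((r/3) powr ((p - 1) * (1 - d)) * (r/3))"
    proof -
      have "(1/12) powr p = (1/4) powr p * (1/3::real) powr p" by (simp flip: powr_mult)
      also have "\<dots> \<le> r powr (p * b - (p - 1) * d) * (1/3) powr ((p - 1) * (1 - d) + 1)"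
      proof (intro mult_mono)
        have "(1/4) powr p \<le> (r powr d) powr p" using rd p by (intro powr_mono2) auto
        also have "\<dots> = r powr (d * p)" by (simp add: powr_powr)
        also have "\<dots> \<le> r powr (p * b - (p - 1) * d)"
        proof (rule powr_mono')
          have "p * b \<le> p * d" "0 \<le> (p - 1) * d" using b p d by auto
          then show "p * b - (p - 1) * d \<le> d * p" by (simp add: mult.commute)
        qed (use r in auto)
        finally show "(1/4) powr p \<le> r powr (p * b - (p - 1) * d)" .
        have "(p - 1) * (1 - d) + 1 \<le> p" using p d by (simp add: algebra_simps)
        then show "(1/3) powr p \<le> (1/3::real) powr ((p - 1) * (1 - d) + 1)" by (intro powr_mono') auto
      qed auto
      also have "r powr (p * b - (p - 1) * d) = r powr (p * b - p) * r powr ((p - 1) * (1 - d) + 1)"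
        by (simp add: algebra_simps flip: powr_add)
      also have "\<dots> * (1/3) powr ((p - 1) * (1 - d) + 1) = r powr (p * b - p) * (r/3) powr ((p - 1) * (1 - d) + 1)"
        using r by (simp add: powr_divide)
      also have "\<dots> = r powr (p * b - p) * ((r/3) powr ((p - 1) * (1 - d)) * (r/3))"
        using r by (simp add: powr_add)
      finally show ?thesis .
    qed
    then have "ennreal ((1/12) powr p) \<le> ennreal (r powr (p * b - p)) * ennreal ((r/3) powr ((p - 1) * (1 - d)) * (r/3))"
      using r by (subst ennreal_mult[symmetric]) (auto intro: ennreal_leI)
    also have "\<dots> \<le> ennreal (measure lebesgue (origin_interval k) powr (p * b - p)) * weight_of v (origin_interval k)"
      using w by (intro mult_mono) (auto simp: measure_origin_interval r_def)
    finally show "ennreal ((1/12) powr p) \<le> ennreal (measure lebesgue (origin_interval k) powr (p * b - p)) * weight_of v (origin_interval k)" .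
  qed
  define N where "N = nat \<lfloor>1 / d\<rfloor>"
  have N: "real k * d \<le> 1" if "k \<le> N" for k
  proof -
    have "real k \<le> 1 / d" using that of_nat_floor[of "1 / d"] d unfolding N_def by (simp add: order_trans[OF of_nat_mono])
    then show ?thesis using d by (simp add: field_simps)
  qed
  have inj: "inj_on origin_interval {..N}"
  proof (rule inj_onI)
    fix j k assume "origin_interval j = origin_interval k"
    then have "(1/4::real) ^ j = (1/4) ^ k" by (metis measure_origin_interval)
    then show "j = k" by (simp add: power_divide)
  qed
  have card: "1 / d \<le> real (card (origin_interval ` {..N}))"
  proof -
    have "real N = of_int \<lfloor>1 / d\<rfloor>" using d by (simp add: N_def)
    then have "1 / d \<le> real N + 1" by linarith
    then show ?thesis using card_image[OF inj] by simp
  qed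
  have "ennreal ((1 / 217) powr p * ((1/12) powr p / d)) = ennreal ((1/217) powr p) * (ennreal (1 / d) * ennreal ((1/12) powr p))"
    using d by (simp flip: ennreal_mult)
  also have "\<dots> \<le> ennreal ((1/217) powr p) * (of_nat (card (origin_interval ` {..N})) * ennreal ((1/12) powr p))"
    using card by (intro mult_left_mono mult_right_mono) (auto simp: ennreal_of_nat_eq_real_of_nat intro: ennreal_leI)
  also have "\<dots> \<le> level_sup p (1/3) b (p * b - p) v f"
    using term_bounds N by (intro level_sum_ge) auto
  finally have lower: "ennreal ((1 / 217) powr p * ((1/12) powr p / d)) \<le> level_sup p (1/3) b (p * b - p) v f" .
  have "f \<in> sobolev p v" using wd norm by (intro in_sobolevI) (auto intro: le_less_trans)
  with wd norm lower show ?thesis using weighted_norm_powr[of p v] p by auto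
qed

section \<open>The lower bounds for the exponent\<close>

lemma abs_powr_in_A_class_1:
  assumes "0 < d" "d \<le> 1"
  shows "(\<lambda>x. \<bar>x\<bar> powr (d - 1)) \<in> A_class 1"
    "1 / 2 \<le> enn2real (A_const 1 (\<lambda>x. \<bar>x\<bar> powr (d - 1)))"
    "enn2real (A_const 1 (\<lambda>x. \<bar>x\<bar> powr (d - 1))) \<le> (4 / d) powr 1"
  using enn2real_bounds[OF A_const_1_abs_powr_lower[OF assms] A_const_1_abs_powr_upper[OF assms]]
    locally_integrable_abs_powr[of "d - 1"] assms
  by (auto simp: A_class_def)

lemma abs_powr_in_A_class:
  assumes "0 < d" "d \<le> 1" "1 < p"
  shows "(\<lambda>x. \<bar>x\<bar> powr ((p - 1) * (1 - d))) \<in> A_class p"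
    "(1 / 2) powr (p - 1) \<le> enn2real (A_const p (\<lambda>x. \<bar>x\<bar> powr ((p - 1) * (1 - d))))"
    "enn2real (A_const p (\<lambda>x. \<bar>x\<bar> powr ((p - 1) * (1 - d)))) \<le> (4 / d) powr (p - 1)"
proof -
  have "0 \<le> (p - 1) * (1 - d)" using assms by simp
  then have "locally_integrable (\<lambda>x. \<bar>x\<bar> powr ((p - 1) * (1 - d)))"
    by (intro locally_integrable_abs_powr) simp
  then show "(\<lambda>x. \<bar>x\<bar> powr ((p - 1) * (1 - d))) \<in> A_class p"
    "(1 / 2) powr (p - 1) \<le> enn2real (A_const p (\<lambda>x. \<bar>x\<bar> powr ((p - 1) * (1 - d))))"
    "enn2real (A_const p (\<lambda>x. \<bar>x\<bar> powr ((p - 1) * (1 - d)))) \<le> (4 / d) powr (p - 1)"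
    using enn2real_bounds[OF A_const_p_abs_powr_lower[OF assms] A_const_p_abs_powr_upper[OF assms]]
    by (auto simp: A_class_def)
qed

lemma ennreal_chain_le:
  assumes "ennreal a \<le> S" "S \<le> ennreal M * N" "N \<le> ennreal b" "0 \<le> M" "0 \<le> b"
  shows "a \<le> M * b"
proof -
  have "ennreal a \<le> ennreal M * ennreal b"
    using assms(1,2) mult_left_mono[OF assms(3), of "ennreal M"] by (meson order_trans zero_le)
  then show ?thesis using assms(4,5) by (simp add: ennreal_le_iff flip: ennreal_mult)
qed

text \<open>The exponent \<open>b\<close> may vary with \<open>d\<close> while \<open>C\<close> does not, so that one argument serves both for the
endpoint inequality (\<open>b = 0\<close>) and for a family of inequalities that approaches the endpoint
(\<open>b = d\<close>).\<close>

lemma A_p_exponent_ge: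
  assumes p: "1 < p" and C: "0 < C" and d0: "0 < d0"
    and bound: "\<And>d. 0 < d \<Longrightarrow> d < d0 \<Longrightarrow> \<exists>b. 0 \<le> b \<and> b \<le> d \<and>
      (\<forall>v f f'. v \<in> A_class p \<longrightarrow> f \<in> sobolev p v \<longrightarrow> has_weak_derivative f f' \<longrightarrow>
         level_sup p (1 / 3) b (p * b - p) v f
         \<le> ennreal (C * enn2real (A_const p v) powr \<gamma>) * ennreal_powr (weighted_norm p v f') p)"
  shows "p / (p - 1) \<le> \<gamma>"
proof -
  define K where "K = (1 / 217) powr p * (1/12) powr p"
  have "p \<le> (p - 1) * \<gamma>"
  proof (rule exponent_comparison)
    fix d :: real assume d: "0 < d" "d < min d0 1"
    let ?v = "\<lambda>x. \<bar>x\<bar> powr ((p - 1) * (1 - d))"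
    define A where "A = enn2real (A_const p ?v)"
    have v: "?v \<in> A_class p" "(1 / 2) powr (p - 1) \<le> A" "A \<le> (4 / d) powr (p - 1)"
      unfolding A_def using abs_powr_in_A_class[of d p] d p by auto
    obtain b where b: "0 \<le> b" "b \<le> d" 
      and bd: "\<And>v f f'. v \<in> A_class p \<Longrightarrow> f \<in> sobolev p v \<Longrightarrow> has_weak_derivative f f' \<Longrightarrow>
         level_sup p (1 / 3) b (p * b - p) v f
         \<le> ennreal (C * enn2real (A_const p v) powr \<gamma>) * ennreal_powr (weighted_norm p v f') p"
      using bound[of d] d by auto
    obtain f g where fg: "f \<in> sobolev p ?v" "has_weak_derivative f g"
      "ennreal_powr (weighted_norm p ?v g) p \<le> ennreal (d powr (p - 1))"
      "ennreal ((1 / 217) powr p * ((1/12) powr p / d)) \<le> level_sup p (1/3) b (p * b - p) ?v f"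
      using truncated_power_test[of d p b] d p b by auto
    have "(1 / 217) powr p * ((1/12) powr p / d) \<le> C * A powr \<gamma> * d powr (p - 1)"
      using ennreal_chain_le[OF fg(4) bd[OF v(1) fg(1,2)] fg(3)] C unfolding A_def by simp
    then have "K * d powr (- p) \<le> C * A powr \<gamma>"
      using d by (simp add: K_def powr_diff powr_minus field_simps)
    with v show "\<exists>A. (1 / 2) powr (p - 1) \<le> A \<and> A \<le> (4 / d) powr (p - 1) \<and> K * d powr (- p) \<le> C * A powr \<gamma>"
      by blast
  qed (use p C d0 in \<open>auto simp: K_def\<close>)
  then show ?thesis using p by (simp add: field_simps)
qed

lemma A_1_exponent_ge:
  assumes p: "1 \<le> p" and C: "0 < C"
    and bound: "\<And>v f f'. v \<in> A_class 1 \<Longrightarrow> f \<in> sobolev p v \<Longrightarrow> has_weak_derivative f f' \<Longrightarrow>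
         level_sup p 0 b e v f
         \<le> ennreal (C * enn2real (A_const 1 v) powr \<gamma>) * ennreal_powr (weighted_norm p v f') p"
  shows "1 \<le> \<gamma>"
proof -
  have "1 \<le> 1 * \<gamma>"
  proof (rule exponent_comparison)
    fix d :: real assume d: "0 < d" "d < 1"
    let ?v = "\<lambda>x. \<bar>x\<bar> powr (d - 1)"
    define A where "A = enn2real (A_const 1 ?v)"
    have v: "?v \<in> A_class 1" "1 / 2 \<le> A" "A \<le> (4 / d) powr 1"
      unfolding A_def using abs_powr_in_A_class_1[of d] d by auto
    obtain f g where fg: "f \<in> sobolev p ?v" "has_weak_derivative f g"
      "ennreal_powr (weighted_norm p ?v g) p \<le> ennreal 1"
      "ennreal ((1 / 33) powr p / (2 * d)) \<le> level_sup p 0 b e ?v f"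
      using ramp_test[of d p e b] d p by auto
    have "(1 / 33) powr p / (2 * d) \<le> C * A powr \<gamma> * 1"
      using ennreal_chain_le[OF fg(4) bound[OF v(1) fg(1,2)] fg(3)] C unfolding A_def by simp
    then have "(1 / 33) powr p / 2 * d powr (- 1) \<le> C * A powr \<gamma>"
      using d by (simp add: powr_minus field_simps)
    with v show "\<exists>A. 1 / 2 \<le> A \<and> A \<le> (4 / d) powr 1 \<and> (1 / 33) powr p / 2 * d powr (- 1) \<le> C * A powr \<gamma>"
      by blast
  qed (use C in auto)
  then show ?thesis by simp
qed

theorem proposition2p11:
  fixes p :: real
  assumes "1 \<le> p"
  shows
    "(\<forall>\<beta> \<gamma> C :: real. 0 < C \<longrightarrow>
        (\<forall>v f f'. v \<in> A_class 1 \<longrightarrow> f \<in> sobolev p v \<longrightarrow> has_weak_derivative f f' \<longrightarrow>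
           (SUP l\<in>{0<..}. ennreal (l powr p) *
              (\<Sum>\<^sub>\<infinity>I\<in>dyadic_level 0 l (\<beta> + 1 - 1 / p) f.
                 ennreal (measure lebesgue I powr (\<beta> * p - 1)) * weight_of v I))
           \<le> ennreal (C * enn2real (A_const 1 v) powr \<gamma>)
              * ennreal_powr (weighted_norm p v f') p)
        \<longrightarrow> \<gamma> \<ge> 1)
     \<and> (1 < p \<longrightarrow> (\<forall>\<gamma> C :: real. 0 < C \<longrightarrow>
        (\<forall>v f f'. v \<in> A_class p \<longrightarrow> f \<in> sobolev p v \<longrightarrow> has_weak_derivative f f' \<longrightarrow>
           (SUP l\<in>{0<..}. ennreal (l powr p) *
              (\<Sum>\<^sub>\<infinity>I\<in>dyadic_level (1 / 3) l 0 f.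
                 ennreal (measure lebesgue I powr (- p)) * weight_of v I))
           \<le> ennreal (C * enn2real (A_const p v) powr \<gamma>)
              * ennreal_powr (weighted_norm p v f') p)
        \<longrightarrow> \<gamma> \<ge> p / (p - 1)))
     \<and> (1 < p \<longrightarrow> (\<forall>\<beta>\<^sub>0 \<gamma> C :: real. \<beta>\<^sub>0 \<in> {1 / p - 1<..<1 / p} \<longrightarrow> 0 < C \<longrightarrow>
        (\<forall>\<beta> v f f'. \<beta> \<in> {1 / p - 1<..<\<beta>\<^sub>0} \<longrightarrow>
           v \<in> A_class p \<longrightarrow> f \<in> sobolev p v \<longrightarrow> has_weak_derivative f f' \<longrightarrow>
           (SUP l\<in>{0<..}. ennreal (l powr p) *
              (\<Sum>\<^sub>\<infinity>I\<in>dyadic_level (1 / 3) l (\<beta> + 1 - 1 / p) f.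
                 ennreal (measure lebesgue I powr (\<beta> * p - 1)) * weight_of v I))
           \<le> ennreal (C * enn2real (A_const p v) powr \<gamma>)
              * ennreal_powr (weighted_norm p v f') p)
        \<longrightarrow> \<gamma> \<ge> p / (p - 1)))"
proof (intro conjI impI allI)
  fix \<beta> \<gamma> C :: real
  assume "0 < C" and *: "\<forall>v f f'. v \<in> A_class 1 \<longrightarrow> f \<in> sobolev p v \<longrightarrow> has_weak_derivative f f' \<longrightarrow>
           level_sup p 0 (\<beta> + 1 - 1 / p) (\<beta> * p - 1) v f
           \<le> ennreal (C * enn2real (A_const 1 v) powr \<gamma>)
              * ennreal_powr (weighted_norm p v f') p"
  from assms this(1) *[rule_format] show "1 \<le> \<gamma>" by (rule A_1_exponent_ge)
next
  fix \<gamma> C :: real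
  assume p: "1 < p" and "0 < C" and *: "\<forall>v f f'. v \<in> A_class p \<longrightarrow> f \<in> sobolev p v \<longrightarrow> has_weak_derivative f f' \<longrightarrow>
           level_sup p (1 / 3) 0 (- p) v f
           \<le> ennreal (C * enn2real (A_const p v) powr \<gamma>)
              * ennreal_powr (weighted_norm p v f') p"
  show "p / (p - 1) \<le> \<gamma>"
  proof (rule A_p_exponent_ge[OF p \<open>0 < C\<close> zero_less_one], rule exI[of _ 0], intro conjI)
    show "\<forall>v f f'. v \<in> A_class p \<longrightarrow> f \<in> sobolev p v \<longrightarrow> has_weak_derivative f f' \<longrightarrow>
           level_sup p (1 / 3) 0 (p * 0 - p) v f
           \<le> ennreal (C * enn2real (A_const p v) powr \<gamma>)
              * ennreal_powr (weighted_norm p v f') p"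
      unfolding mult_zero_right diff_0 by (rule *)
  qed auto
next
  fix \<beta>\<^sub>0 \<gamma> C :: real
  assume p: "1 < p" and \<beta>\<^sub>0: "\<beta>\<^sub>0 \<in> {1 / p - 1<..<1 / p}" and "0 < C"
    and *: "\<forall>\<beta> v f f'. \<beta> \<in> {1 / p - 1<..<\<beta>\<^sub>0} \<longrightarrow>
           v \<in> A_class p \<longrightarrow> f \<in> sobolev p v \<longrightarrow> has_weak_derivative f f' \<longrightarrow>
           level_sup p (1 / 3) (\<beta> + 1 - 1 / p) (\<beta> * p - 1) v f
           \<le> ennreal (C * enn2real (A_const p v) powr \<gamma>)
              * ennreal_powr (weighted_norm p v f') p"
  have "0 < \<beta>\<^sub>0 - (1 / p - 1)" using \<beta>\<^sub>0 by simp
  then show "p / (p - 1) \<le> \<gamma>"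
  proof (rule A_p_exponent_ge[OF p \<open>0 < C\<close>])
    fix d assume d: "0 < d" "d < \<beta>\<^sub>0 - (1 / p - 1)"
    \<comment> \<open>This choice makes the exponent of \<open>|I|\<close> in the level condition equal to \<open>d\<close>.\<close>
    define \<beta> where "\<beta> = 1 / p - 1 + d"
    have \<beta>: "\<beta> \<in> {1 / p - 1<..<\<beta>\<^sub>0}" using d by (simp add: \<beta>_def)
    have exps: "\<beta> + 1 - 1 / p = d" "\<beta> * p - 1 = p * d - p"
      using p by (simp_all add: \<beta>_def field_simps)
    show "\<exists>b. 0 \<le> b \<and> b \<le> d \<and>
      (\<forall>v f f'. v \<in> A_class p \<longrightarrow> f \<in> sobolev p v \<longrightarrow> has_weak_derivative f f' \<longrightarrow>
         level_sup p (1 / 3) b (p * b - p) v f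
         \<le> ennreal (C * enn2real (A_const p v) powr \<gamma>) * ennreal_powr (weighted_norm p v f') p)"
      using *[rule_format, OF \<beta>] d unfolding exps by (intro exI[of _ d]) auto
  qed
qed

end
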